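(* Let $b,c$ be integers with $c > b \geq 3$. For integers $x,y,z$ let $P(x,y,z) = \{(m,n) : 0 \le m \le x,\ 0 \le n \le y,\ m+n = z\}$, and define \[ g(b,c) = 5 + \sum_{i=2}^{b} \sum_{j=0}^{i} \left|P(i, b-i, j)\right| \cdot \left|P(i, c-i, j)\right|. \] Then $g(b,c) \leq \left|\mathcal{F}(K_{2,b,c})\right|$.
   Context: All graphs are finite, undirected and simple, and are considered up to isomorphism. $K_{2,b,c}$ is the complete tripartite graph with parts of sizes $2,b,c$. A Triangle-Y ($\nabla Y$) move on a graph takes a 3-cycle with vertices $x,y,z$, deletes the edges $xy,yz,zx$, and adds a new vertex $v$ with edges $xv,yv,zv$. A Y-Triangle ($Y\nabla$) move is the inverse operation: for a vertex $v$ of degree three whose neighbours $x,y,z$ are pairwise non-adjacent, delete $v$ and add the edges $xy,yz,zx$. Two graphs are cousins if one is obtained from the other by a sequence of zero or more $\nabla Y$ and $Y\nabla$ moves. The family $\mathcal{F}(G)$ is the set of (isomorphism classes of) cousins of $G$, and $|\mathcal{F}(G)|$ is its size. *)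

theory Defs
  imports "Graph_Theory.Graph_Theory"
begin

text \<open>
  A finite simple undirected graph is a \<^locale>\<open>pair_graph\<close>: an edge is represented by its two
  opposite arcs. Vertices are natural numbers, so that every finite graph has an isomorphic copy
  and a fresh vertex is always available for a Triangle-Y move.
\<close>

definition edges_of :: "'a rel \<Rightarrow> 'a rel" where
  "edges_of A = A \<union> A\<inverse>"

definition complete_tripartite :: "nat \<Rightarrow> nat \<Rightarrow> nat \<Rightarrow> nat pair_pre_digraph" where
  "complete_tripartite a b c =
    (let A = {0..<a}; B = {a..<a + b}; C = {a + b..<a + b + c}
     in \<lparr> pverts = A \<union> B \<union> C, parcs = edges_of (A \<times> B \<union> A \<times> C \<union> B \<times> C) \<rparr>)"

definition triangle_Y :: "nat pair_pre_digraph \<Rightarrow> nat pair_pre_digraph \<Rightarrow> bool" where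
  "triangle_Y G H \<longleftrightarrow> pair_graph G \<and>
    (\<exists>x y z v. distinct [x, y, z] \<and> {(x, y), (y, z), (z, x)} \<subseteq> parcs G \<and> v \<notin> pverts G \<and>
      H = \<lparr> pverts = insert v (pverts G),
            parcs = (parcs G - edges_of {(x, y), (y, z), (z, x)})
                      \<union> edges_of {(x, v), (y, v), (z, v)} \<rparr>)"

definition Y_triangle :: "nat pair_pre_digraph \<Rightarrow> nat pair_pre_digraph \<Rightarrow> bool" where
  "Y_triangle G H \<longleftrightarrow> pair_graph G \<and>
    (\<exists>x y z v. distinct [x, y, z] \<and> v \<in> pverts G \<and> {w. (v, w) \<in> parcs G} = {x, y, z} \<and>
      (x, y) \<notin> parcs G \<and> (y, z) \<notin> parcs G \<and> (z, x) \<notin> parcs G \<and>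
      H = \<lparr> pverts = pverts G - {v},
            parcs = (parcs G - edges_of {(x, v), (y, v), (z, v)})
                      \<union> edges_of {(x, y), (y, z), (z, x)} \<rparr>)"

definition cousins :: "nat pair_pre_digraph \<Rightarrow> nat pair_pre_digraph \<Rightarrow> bool" where
  "cousins = (\<lambda>G H. triangle_Y G H \<or> Y_triangle G H)\<^sup>*\<^sup>*"

definition iso_class :: "nat pair_pre_digraph \<Rightarrow> nat pair_pre_digraph set" where
  "iso_class G = {H. pair_graph H \<and> digraph_iso (with_proj G) (with_proj H)}"

definition family :: "nat pair_pre_digraph \<Rightarrow> nat pair_pre_digraph set set" where
  "family G = iso_class ` {H. cousins G H}"

definition pairs_P :: "int \<Rightarrow> int \<Rightarrow> int \<Rightarrow> (int \<times> int) set" where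
  "pairs_P x y z = {(m, n). 0 \<le> m \<and> m \<le> x \<and> 0 \<le> n \<and> n \<le> y \<and> m + n = z}"

definition g_bound :: "nat \<Rightarrow> nat \<Rightarrow> nat" where
  "g_bound b c = 5 + (\<Sum>i = 2..b. \<Sum>j = 0..i.
     card (pairs_P (int i) (int b - int i) (int j)) * card (pairs_P (int i) (int c - int i) (int j)))"

end

theory Submission
  imports Defs "HOL-Library.Countable"
begin

text \<open>
  Only Triangle-Y moves on edge-disjoint triangles of the complete tripartite graph are needed. Every
  triangle contains exactly one of the two vertices of the small part, so such a set of triangles
  is a pair of disjoint matchings \<open>M\<close>, \<open>N\<close> between the parts of sizes \<open>b\<close> and \<open>c\<close>. Put
  \<open>i = card M\<close> and \<open>j = card N\<close> with \<open>j \<le> i\<close>, and let \<open>m\<close> and \<open>n\<close> be the numbers of vertices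
  in the two large parts that both matchings cover. The number of quadruples \<open>(i, j, m, n)\<close> that occur is
  the bound: those with \<open>i \<ge> 2\<close> give the double sum and those with \<open>i \<le> 1\<close> the summand 5.

  The quadruple is an isomorphism invariant. A move lowers the degree of each corner of the triangle by one, so
  the two small vertices have degrees \<open>b + c - i\<close> and \<open>b + c - j\<close>, a vertex of the \<open>b\<close>-part has
  degree \<open>c + 2\<close>, \<open>c + 1\<close> or \<open>c\<close>, and one of the \<open>c\<close>-part has degree \<open>b + 2\<close>, \<open>b + 1\<close>
  or \<open>b\<close>. The number of vertices gives \<open>i + j\<close>. Suppose that \<open>i\<close> is larger in the first of two
  isomorphic graphs. Its vertex of degree \<open>b + c - j\<close> then forces \<open>b + c - j \<le> c + 2\<close>, which leaves only
  \<open>(i, j) = (b, b - 2)\<close> against \<open>(b - 1, b - 1)\<close>, and a path with vertex degrees \<open>c + 2, 3, c\<close> separates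
  these. With \<open>i\<close> and \<open>j\<close> known, the numbers of vertices of degrees \<open>c + 2\<close> and \<open>b\<close> give \<open>m\<close> and \<open>n\<close>.
\<close>

subsection \<open>Isomorphisms and degrees\<close>

lemma pair_graph_iff:
  "pair_graph G \<longleftrightarrow>
    finite (pverts G) \<and> parcs G \<subseteq> pverts G \<times> pverts G \<and> sym (parcs G) \<and> irrefl (parcs G)"
proof
  assume "pair_graph G"
  then interpret pair_graph G .
  show "finite (pverts G) \<and> parcs G \<subseteq> pverts G \<times> pverts G \<and> sym (parcs G) \<and> irrefl (parcs G)"
    using pair_finite_verts pair_sym_arcs pair_no_loops arc_fst_in_verts arc_snd_in_verts
    by (fastforce simp: symmetric_def irrefl_def)
next
  assume *: "finite (pverts G) \<and> parcs G \<subseteq> pverts G \<times> pverts G \<and> sym (parcs G) \<and> irrefl (parcs G)"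
  then have "finite (parcs G)" by (meson finite_SigmaI finite_subset)
  with * show "pair_graph G"
    by unfold_locales (auto simp: symmetric_def irrefl_def)
qed

lemma pair_graph_arcsD:
  assumes "pair_graph G" "(u, w) \<in> parcs G"
  shows "u \<in> pverts G" "w \<in> pverts G" "(w, u) \<in> parcs G"
  using assms by (auto simp: pair_graph_iff dest: symD)

text \<open>On both sides the tail and head maps are \<open>fst\<close> and \<open>snd\<close>,
  which forces an isomorphism to act on each arc coordinatewise; its vertex map alone carries the
  information.\<close>

lemma digraph_iso_with_proj_iff:
  assumes "pair_wf_digraph G"
  shows "digraph_iso (with_proj G) (with_proj H) \<longleftrightarrow>
    (\<exists>f. inj_on f (pverts G) \<and> pverts H = f ` pverts G \<and> parcs H = map_prod f f ` parcs G)"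
    (is "?L \<longleftrightarrow> ?R")
proof
  interpret pair_wf_digraph G by fact
  assume ?L
  then obtain h where h: "pre_digraph.digraph_isomorphism (with_proj G) h"
    and H: "with_proj H = app_iso h (with_proj G)"
    unfolding digraph_iso_def by auto
  have "tail (with_proj H) = iso_tail h" "head (with_proj H) = iso_head h"
    unfolding H by simp_all
  then have ht: "iso_tail h = fst" "iso_head h = snd" by simp_all
  have arcs: "iso_arcs h e = map_prod (iso_verts h) (iso_verts h) e" if "e \<in> parcs G" for e
    using h that unfolding pre_digraph.digraph_isomorphism_def
    by (cases e) (auto simp: ht prod_eq_iff)
  have "verts (with_proj H) = iso_verts h ` pverts G" "arcs (with_proj H) = iso_arcs h ` parcs G"
    unfolding H by simp_all
  then have "pverts H = iso_verts h ` pverts G"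
    "parcs H = map_prod (iso_verts h) (iso_verts h) ` parcs G"
    using arcs by (auto cong: image_cong)
  moreover have "inj_on (iso_verts h) (pverts G)"
    using h unfolding pre_digraph.digraph_isomorphism_def by simp
  ultimately show ?R by blast
next
  interpret pair_wf_digraph G by fact
  assume ?R
  then obtain f where f: "inj_on f (pverts G)" and v: "pverts H = f ` pverts G"
    and a: "parcs H = map_prod f f ` parcs G" by blast
  let ?h = "\<lparr> iso_verts = f, iso_arcs = map_prod f f, iso_head = snd, iso_tail = fst \<rparr>"
  have "parcs G \<subseteq> pverts G \<times> pverts G"
    using in_arcsD1 in_arcsD2 by auto
  then have "inj_on (map_prod f f) (parcs G)"
    using inj_on_subset[OF map_prod_inj_on[OF f f]] by blast
  then have "pre_digraph.digraph_isomorphism (with_proj G) ?h"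
    unfolding pre_digraph.digraph_isomorphism_def
    using f wf_digraph_axioms by simp
  moreover have "with_proj H = app_iso ?h (with_proj G)"
    by (simp add: with_proj_def app_iso_def v a)
  ultimately show ?L unfolding digraph_iso_def by blast
qed

lemma pair_graph_imp_wf: "pair_graph G \<Longrightarrow> pair_wf_digraph G"
  by (simp add: pair_graph.axioms(1) pair_digraph.axioms(1) pair_fin_digraph.axioms(1))

lemma digraph_iso_with_proj_sym:
  assumes "pair_wf_digraph G" "digraph_iso (with_proj G) (with_proj H)"
  shows "digraph_iso (with_proj H) (with_proj G)"
proof -
  interpret pair_wf_digraph G by fact
  obtain h where h: "pre_digraph.digraph_isomorphism (with_proj G) h"
    and H: "with_proj H = app_iso h (with_proj G)"
    using assms(2) unfolding digraph_iso_def by auto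
  show ?thesis
    using digraph_isomorphism_invI[OF h] pre_digraph.app_iso_inv[OF h] H
    unfolding digraph_iso_def by metis
qed

lemma digraph_iso_with_proj_trans:
  assumes "pair_wf_digraph G" "pair_wf_digraph H"
    and "digraph_iso (with_proj G) (with_proj H)" "digraph_iso (with_proj H) (with_proj K)"
  shows "digraph_iso (with_proj G) (with_proj K)"
proof -
  obtain f where f: "inj_on f (pverts G)" "pverts H = f ` pverts G" "parcs H = map_prod f f ` parcs G"
    using digraph_iso_with_proj_iff[OF assms(1), THEN iffD1, OF assms(3)] by (elim exE conjE)
  obtain g where g: "inj_on g (pverts H)" "pverts K = g ` pverts H" "parcs K = map_prod g g ` parcs H"
    using digraph_iso_with_proj_iff[OF assms(2), THEN iffD1, OF assms(4)] by (elim exE conjE)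
  have "inj_on (g \<circ> f) (pverts G)" using f g by (simp add: comp_inj_on)
  moreover have "pverts K = (g \<circ> f) ` pverts G" "parcs K = map_prod (g \<circ> f) (g \<circ> f) ` parcs G"
    using f g by (simp_all add: image_comp map_prod_compose)
  ultimately show ?thesis using digraph_iso_with_proj_iff[OF assms(1)] by blast
qed

text \<open>Lets isomorphism invariants tell members of \<open>family\<close> apart. Forwards, it
  suffices that \<open>H\<close> lies in its own class.\<close>

lemma iso_class_eq_iff:
  assumes "pair_graph G" "pair_graph H"
  shows "iso_class G = iso_class H \<longleftrightarrow> digraph_iso (with_proj G) (with_proj H)"
proof
  assume "iso_class G = iso_class H"
  moreover have "digraph_iso (with_proj H) (with_proj H)"
    unfolding digraph_iso_with_proj_iff[OF pair_graph_imp_wf[OF assms(2)]]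
    by (rule exI[of _ id]) (simp add: map_prod.id)
  ultimately show "digraph_iso (with_proj G) (with_proj H)"
    using assms(2) unfolding iso_class_def by blast
next
  assume "digraph_iso (with_proj G) (with_proj H)"
  then show "iso_class G = iso_class H"
    using assms digraph_iso_with_proj_trans digraph_iso_with_proj_sym pair_graph_imp_wf
    unfolding iso_class_def by blast
qed

section \<open>Degree counts and degree paths as isomorphism invariants\<close>

definition deg :: "'a pair_pre_digraph \<Rightarrow> 'a \<Rightarrow> nat" where
  "deg G v = card (parcs G `` {v})"

definition deg_count :: "'a pair_pre_digraph \<Rightarrow> nat \<Rightarrow> nat" where
  "deg_count G d = card {v \<in> pverts G. deg G v = d}"

lemma deg_image:
  assumes "parcs G \<subseteq> pverts G \<times> pverts G" "inj_on f (pverts G)" "parcs H = map_prod f f ` parcs G"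
    and "v \<in> pverts G"
  shows "deg H (f v) = deg G v"
proof -
  have "parcs H `` {f v} = f ` (parcs G `` {v})"
    using assms by (force dest: inj_onD)
  moreover have "inj_on f (parcs G `` {v})"
    using assms by (auto intro: inj_on_subset)
  ultimately show ?thesis by (simp add: deg_def card_image)
qed

lemma deg_count_iso:
  assumes "pair_graph G" "digraph_iso (with_proj G) (with_proj H)"
  shows "deg_count H d = deg_count G d"
proof -
  obtain f where f: "inj_on f (pverts G)" "pverts H = f ` pverts G" "parcs H = map_prod f f ` parcs G"
    using digraph_iso_with_proj_iff[OF pair_graph_imp_wf[OF assms(1)], THEN iffD1, OF assms(2)]
    by (elim exE conjE)
  have sub: "parcs G \<subseteq> pverts G \<times> pverts G" using assms(1) by (simp add: pair_graph_iff)
  have "{v \<in> pverts H. deg H v = d} = f ` {v \<in> pverts G. deg G v = d}"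
    using deg_image[OF sub f(1,3)] f(2) by auto
  moreover have "inj_on f {v \<in> pverts G. deg G v = d}"
    using f(1) by (auto intro: inj_on_subset)
  ultimately show ?thesis by (simp add: deg_count_def card_image)
qed

lemma card_pverts_iso:
  assumes "pair_graph G" "digraph_iso (with_proj G) (with_proj H)"
  shows "card (pverts H) = card (pverts G)"
  using digraph_iso_with_proj_iff[OF pair_graph_imp_wf[OF assms(1)], THEN iffD1, OF assms(2)]
  by (elim exE conjE) (simp add: card_image)

text \<open>The end vertices may coincide in general; with the degrees \<open>c + 2\<close> and
  \<open>c\<close> used below they cannot.\<close>

definition has_deg_path :: "'a pair_pre_digraph \<Rightarrow> nat \<Rightarrow> nat \<Rightarrow> nat \<Rightarrow> bool" where
  "has_deg_path G p q r \<longleftrightarrow> (\<exists>u v w. (u, v) \<in> parcs G \<and> (v, w) \<in> parcs G \<and>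
     deg G u = p \<and> deg G v = q \<and> deg G w = r)"

lemma has_deg_path_iso:
  assumes "pair_graph G" "digraph_iso (with_proj G) (with_proj H)" "has_deg_path G p q r"
  shows "has_deg_path H p q r"
proof -
  obtain f where f: "inj_on f (pverts G)" "pverts H = f ` pverts G" "parcs H = map_prod f f ` parcs G"
    using digraph_iso_with_proj_iff[OF pair_graph_imp_wf[OF assms(1)], THEN iffD1, OF assms(2)]
    by (elim exE conjE)
  have sub: "parcs G \<subseteq> pverts G \<times> pverts G" using assms(1) by (simp add: pair_graph_iff)
  obtain u v w where *: "(u, v) \<in> parcs G" "(v, w) \<in> parcs G"
    "deg G u = p" "deg G v = q" "deg G w = r"
    using assms(3) unfolding has_deg_path_def by blast
  then have "(f u, f v) \<in> parcs H" "(f v, f w) \<in> parcs H"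
    using f(3) by auto
  moreover have "deg H (f u) = p" "deg H (f v) = q" "deg H (f w) = r"
    using * sub deg_image[OF sub f(1,3)] by auto
  ultimately show ?thesis unfolding has_deg_path_def by blast
qed

subsection \<open>Finiteness of the family\<close>

lemma card_edges_of_triangle:
  "distinct [x, y, z] \<Longrightarrow> card (edges_of {(x, y), (y, z), (z, x)}) = 6"
  by (auto simp: edges_of_def card_insert_if)

lemma card_edges_of_star:
  "distinct [x, y, z, v] \<Longrightarrow> card (edges_of {(x, v), (y, v), (z, v)}) = 6"
  by (auto simp: edges_of_def card_insert_if)

text \<open>The counting shared by both moves, each of which replaces six arcs by six arcs that were
  absent.\<close>

lemma card_exchange:
  assumes "finite P" "S \<subseteq> P" "R \<inter> P = {}" "finite R" "card S = card R"
  shows "card (P - S \<union> R) = card P"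
proof -
  have "card (P - S \<union> R) = card (P - S) + card R"
    using assms by (intro card_Un_disjoint) auto
  also have "\<dots> = card P" using assms
    by (metis card_Diff_subset card_mono finite_subset le_add_diff_inverse2)
  finally show ?thesis .
qed

text \<open>The domain suffices because the arc relation of a pair graph is symmetric.\<close>

definition no_isolated :: "'a pair_pre_digraph \<Rightarrow> bool" where
  "no_isolated G \<longleftrightarrow> pverts G \<subseteq> Domain (parcs G)"

lemma triangle_Y_invariants:
  assumes "triangle_Y G H"
  shows "pair_graph H" "card (parcs H) = card (parcs G)" "no_isolated G \<Longrightarrow> no_isolated H"
proof -
  obtain x y z v where G: "pair_graph G" and d: "distinct [x, y, z]"
    and tri: "{(x, y), (y, z), (z, x)} \<subseteq> parcs G" and v: "v \<notin> pverts G"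
    and H: "H = \<lparr> pverts = insert v (pverts G),
            parcs = (parcs G - edges_of {(x, y), (y, z), (z, x)})
                      \<union> edges_of {(x, v), (y, v), (z, v)} \<rparr>"
    using assms unfolding triangle_Y_def by blast
  have G': "finite (pverts G)" "parcs G \<subseteq> pverts G \<times> pverts G" "sym (parcs G)" "irrefl (parcs G)"
    using G by (simp_all add: pair_graph_iff)
  have xyz: "x \<in> pverts G" "y \<in> pverts G" "z \<in> pverts G" using tri G'(2) by auto
  have vn: "v \<noteq> x" "v \<noteq> y" "v \<noteq> z" using v xyz by auto
  show "pair_graph H"
    unfolding pair_graph_iff
  proof (intro conjI)
    show "sym (parcs H)" using G'(3) by (auto simp: H edges_of_def sym_def)
    show "irrefl (parcs H)" using G'(4) vn by (auto simp: H edges_of_def irrefl_def)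
    show "parcs H \<subseteq> pverts H \<times> pverts H" using G'(2) xyz by (auto simp: H edges_of_def)
  qed (use G' in \<open>auto simp: H\<close>)
  have fin: "finite (parcs G)" using G'(1,2) by (meson finite_SigmaI finite_subset)
  have "edges_of {(x, y), (y, z), (z, x)} \<subseteq> parcs G"
    using tri G'(3) by (auto simp: edges_of_def sym_def)
  moreover have "edges_of {(x, v), (y, v), (z, v)} \<inter> parcs G = {}"
    using v G'(2) by (auto simp: edges_of_def)
  moreover have "finite (edges_of {(x, v), (y, v), (z, v)})"
    by (simp add: edges_of_def)
  moreover have "card (edges_of {(x, y), (y, z), (z, x)}) = card (edges_of {(x, v), (y, v), (z, v)})"
    using card_edges_of_triangle[OF d] card_edges_of_star[of x y z v] d vn by simp
  ultimately show "card (parcs H) = card (parcs G)"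
    using fin by (simp add: H card_exchange)
  show "no_isolated H" if "no_isolated G"
  proof -
    have "u \<in> Domain (parcs H)" if u: "u \<in> pverts H" for u
    proof (cases "u \<in> {x, y, z, v}")
      case True
      then show ?thesis by (auto simp: H edges_of_def)
    next
      case False
      then have "u \<in> Domain (parcs G)" using \<open>no_isolated G\<close> u by (auto simp: H no_isolated_def)
      then show ?thesis using False by (auto simp: H edges_of_def)
    qed
    then show ?thesis by (auto simp: no_isolated_def)
  qed
qed

lemma Y_triangle_invariants:
  assumes "Y_triangle G H"
  shows "pair_graph H" "card (parcs H) = card (parcs G)" "no_isolated G \<Longrightarrow> no_isolated H"
proof -
  obtain x y z v where G: "pair_graph G" and d: "distinct [x, y, z]"
    and v: "v \<in> pverts G" and nb: "{w. (v, w) \<in> parcs G} = {x, y, z}"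
    and na: "(x, y) \<notin> parcs G" "(y, z) \<notin> parcs G" "(z, x) \<notin> parcs G"
    and H: "H = \<lparr> pverts = pverts G - {v},
            parcs = (parcs G - edges_of {(x, v), (y, v), (z, v)})
                      \<union> edges_of {(x, y), (y, z), (z, x)} \<rparr>"
    using assms unfolding Y_triangle_def by blast
  have G': "finite (pverts G)" "parcs G \<subseteq> pverts G \<times> pverts G" "sym (parcs G)" "irrefl (parcs G)"
    using G by (simp_all add: pair_graph_iff)
  have vx: "(v, x) \<in> parcs G" "(v, y) \<in> parcs G" "(v, z) \<in> parcs G" using nb by auto
  have xyz: "x \<in> pverts G" "y \<in> pverts G" "z \<in> pverts G" using vx G'(2) by auto
  have vn: "v \<noteq> x" "v \<noteq> y" "v \<noteq> z" using vx G'(4) by (auto simp: irrefl_def)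
  \<comment> \<open>The deleted vertex has no neighbours besides \<open>x\<close>, \<open>y\<close>,
    \<open>z\<close>, so no arc at \<open>v\<close> survives the move.\<close>
  have nbv: "w = x \<or> w = y \<or> w = z" if "(v, w) \<in> parcs G \<or> (w, v) \<in> parcs G" for w
    using nb that G'(3) by (auto simp: sym_def)
  show "pair_graph H"
    unfolding pair_graph_iff
  proof (intro conjI)
    show "sym (parcs H)" using G'(3) by (auto simp: H edges_of_def sym_def)
    show "irrefl (parcs H)" using G'(4) d by (auto simp: H edges_of_def irrefl_def)
    show "parcs H \<subseteq> pverts H \<times> pverts H" using G'(2) xyz vn nbv by (auto simp: H edges_of_def)
  qed (use G' in \<open>auto simp: H\<close>)
  have fin: "finite (parcs G)" using G'(1,2) by (meson finite_SigmaI finite_subset)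
  have "edges_of {(x, v), (y, v), (z, v)} \<subseteq> parcs G"
    using vx G'(3) by (auto simp: edges_of_def sym_def)
  moreover have "edges_of {(x, y), (y, z), (z, x)} \<inter> parcs G = {}"
    using na G'(3) by (auto simp: edges_of_def sym_def)
  moreover have "finite (edges_of {(x, y), (y, z), (z, x)})"
    by (simp add: edges_of_def)
  moreover have "card (edges_of {(x, v), (y, v), (z, v)}) = card (edges_of {(x, y), (y, z), (z, x)})"
    using card_edges_of_triangle[OF d] card_edges_of_star[of x y z v] d vn by simp
  ultimately show "card (parcs H) = card (parcs G)"
    using fin by (simp add: H card_exchange)
  show "no_isolated H" if "no_isolated G"
  proof -
    have "u \<in> Domain (parcs H)" if u: "u \<in> pverts H" for u
    proof (cases "u \<in> {x, y, z}")
      case True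
      then show ?thesis by (auto simp: H edges_of_def)
    next
      case False
      then have "u \<in> Domain (parcs G)" using \<open>no_isolated G\<close> u by (auto simp: H no_isolated_def)
      moreover have "u \<noteq> v" using u by (simp add: H)
      ultimately show ?thesis using False by (auto simp: H edges_of_def)
    qed
    then show ?thesis by (auto simp: no_isolated_def)
  qed
qed

lemma cousins_invariants:
  assumes "cousins G H" "pair_graph G" "no_isolated G"
  shows "pair_graph H \<and> card (parcs H) = card (parcs G) \<and> no_isolated H"
  using assms unfolding cousins_def
  by (induction rule: rtranclp_induct)
     (auto dest: triangle_Y_invariants Y_triangle_invariants)

text \<open>
  Both moves preserve the number of edges and create no isolated vertex, so the number of vertices
  of a cousin is bounded. Finiteness matters because the cardinality of an infinite set is 0.
\<close>

lemma finite_family: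
  assumes "pair_graph G" "no_isolated G"
  shows "finite (family G)"
proof -
  define E where "E = card (parcs G)"
  \<comment> \<open>Finitely many labelled graphs on vertices below \<open>E\<close>; every cousin
    will be relabelled into one of them.\<close>
  define S :: "nat pair_pre_digraph set" where
    "S = (\<lambda>(V, A). \<lparr> pverts = V, parcs = A \<rparr>) ` (Pow {..<E} \<times> Pow ({..<E} \<times> {..<E}))"
  have "finite S" by (simp add: S_def)
  moreover have "iso_class H \<in> iso_class ` S" if "cousins G H" for H
  proof -
    have H: "pair_graph H" "card (parcs H) = E" "no_isolated H"
      using cousins_invariants[OF that assms] by (auto simp: E_def)
    then have H': "finite (pverts H)" "parcs H \<subseteq> pverts H \<times> pverts H"
      "sym (parcs H)" "irrefl (parcs H)"
      by (simp_all add: pair_graph_iff)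
    then have fin: "finite (parcs H)" by (meson finite_SigmaI finite_subset)
    \<comment> \<open>Each vertex is the first component of some arc, and there are \<open>E\<close>
      arcs.\<close>
    have "card (pverts H) \<le> card (fst ` parcs H)"
      using H(3) fin by (intro card_mono) (auto simp: no_isolated_def Domain_fst)
    also have "\<dots> \<le> E" using H(2) card_image_le[OF fin] by auto
    finally have le: "card (pverts H) \<le> E" .
    obtain f where f: "bij_betw f (pverts H) {0..<card (pverts H)}"
      using ex_bij_betw_finite_nat[OF H'(1)] by blast
    have inj: "inj_on f (pverts H)" using f by (simp add: bij_betw_def)
    let ?K = "\<lparr> pverts = f ` pverts H, parcs = map_prod f f ` parcs H \<rparr>"
    have sub: "f ` pverts H \<subseteq> {..<E}" using f le by (auto simp: bij_betw_def)
    then have "?K \<in> S"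
      unfolding S_def using H'(2) by (intro image_eqI[of _ _ "(f ` pverts H, map_prod f f ` parcs H)"]) auto
    moreover have K: "pair_graph ?K"
      unfolding pair_graph_iff
    proof (intro conjI)
      show "sym (parcs ?K)"
      proof (rule symI)
        fix p q assume "(p, q) \<in> parcs ?K"
        then obtain u w where "(u, w) \<in> parcs H" "p = f u" "q = f w" by auto
        then show "(q, p) \<in> parcs ?K" using H'(3) by (auto dest: symD)
      qed
      show "irrefl (parcs ?K)"
      proof (rule irreflI)
        fix p show "(p, p) \<notin> parcs ?K"
        proof
          assume "(p, p) \<in> parcs ?K"
          then obtain u w where uw: "(u, w) \<in> parcs H" "f u = f w" by auto
          then have "u = w" using H'(2) inj by (auto dest: inj_onD)
          then show False using uw H'(4) by (simp add: irrefl_def)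
        qed
      qed
    qed (use H' in auto)
    moreover have "digraph_iso (with_proj H) (with_proj ?K)"
      unfolding digraph_iso_with_proj_iff[OF pair_graph_imp_wf[OF H(1)]]
      by (intro exI[of _ f]) (simp add: inj)
    ultimately show ?thesis using iso_class_eq_iff[OF H(1) K] by simp
  qed
  then have "family G \<subseteq> iso_class ` S" unfolding family_def by auto
  ultimately show ?thesis using finite_subset by blast
qed

subsection \<open>Triangle-Y moves on edge-disjoint triangles\<close>

fun corners :: "'a \<times> 'a \<times> 'a \<Rightarrow> 'a set" where
  "corners (x, y, z) = {x, y, z}"

fun triangle_arcs :: "'a \<times> 'a \<times> 'a \<Rightarrow> 'a rel" where
  "triangle_arcs (x, y, z) = edges_of {(x, y), (y, z), (z, x)}"

fun star_arcs :: "'a \<Rightarrow> 'a \<times> 'a \<times> 'a \<Rightarrow> 'a rel" where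
  "star_arcs v (x, y, z) = edges_of {(x, v), (y, v), (z, v)}"

text \<open>Models the Triangle-Y moves on all of \<open>T\<close> at once, \<open>h t\<close> being
  the new vertex for \<open>t\<close>, so the order of the moves is irrelevant.\<close>

definition expand ::
  "'a pair_pre_digraph \<Rightarrow> ('a \<times> 'a \<times> 'a \<Rightarrow> 'a) \<Rightarrow> ('a \<times> 'a \<times> 'a) set \<Rightarrow> 'a pair_pre_digraph"
  where "expand G h T = \<lparr> pverts = pverts G \<union> h ` T,
    parcs = (parcs G - \<Union>(triangle_arcs ` T)) \<union> (\<Union>t\<in>T. star_arcs (h t) t) \<rparr>"

text \<open>Disjointness of the arcs keeps each triangle intact while moves are made on the
  others.\<close>

locale disjoint_triangles =
  fixes G :: "nat pair_pre_digraph" and h :: "nat \<times> nat \<times> nat \<Rightarrow> nat"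
    and T :: "(nat \<times> nat \<times> nat) set"
  assumes graph: "pair_graph G"
    and finite_T: "finite T"
    and triangle_distinct: "(x, y, z) \<in> T \<Longrightarrow> distinct [x, y, z]"
    and triangle_in: "t \<in> T \<Longrightarrow> triangle_arcs t \<subseteq> parcs G"
    and arcs_disjoint: "s \<in> T \<Longrightarrow> t \<in> T \<Longrightarrow> s \<noteq> t \<Longrightarrow> triangle_arcs s \<inter> triangle_arcs t = {}"
    and inj_h: "inj_on h T"
    and fresh_h: "t \<in> T \<Longrightarrow> h t \<notin> pverts G"

lemma disjoint_triangles_subset:
  assumes "disjoint_triangles G h T" "S \<subseteq> T"
  shows "disjoint_triangles G h S"
proof -
  interpret disjoint_triangles G h T by fact
  show ?thesis
  proof (rule disjoint_triangles.intro)
    show "finite S" "inj_on h S"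
      using assms(2) finite_T inj_h by (auto intro: finite_subset inj_on_subset)
  qed (use assms(2) graph triangle_distinct triangle_in arcs_disjoint fresh_h in blast)+
qed

context disjoint_triangles
begin

lemma corners_in: "t \<in> T \<Longrightarrow> corners t \<subseteq> pverts G"
  using triangle_in[of t] graph by (cases t) (auto simp: pair_graph_iff edges_of_def)

text \<open>Old arcs miss the fresh vertex, and injectivity of \<open>h\<close> rules out the stars
  of the other triangles.\<close>

lemma expand_nbrs_fresh:
  assumes "t \<in> T"
  shows "parcs (expand G h T) `` {h t} = corners t"
proof -
  have sub: "parcs G \<subseteq> pverts G \<times> pverts G" using graph by (simp add: pair_graph_iff)
  have "w \<in> corners t" if w: "(h t, w) \<in> parcs (expand G h T)" for w
  proof -
    have "(h t, w) \<notin> parcs G" using sub fresh_h[OF assms] by auto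
    then obtain s where s: "s \<in> T" "(h t, w) \<in> star_arcs (h s) s"
      using w by (simp add: expand_def) blast
    have "h t \<notin> corners s" using corners_in[OF s(1)] fresh_h[OF assms] by auto
    then have "h s = h t \<and> w \<in> corners s"
      using s(2) by (cases s) (auto simp: edges_of_def)
    then show ?thesis using inj_onD[OF inj_h, of s t] s(1) assms by auto
  qed
  moreover have "(h t, w) \<in> parcs (expand G h T)" if "w \<in> corners t" for w
  proof -
    have "(h t, w) \<in> star_arcs (h t) t" using that by (cases t) (auto simp: edges_of_def)
    then show ?thesis using assms by (auto simp: expand_def)
  qed
  ultimately show ?thesis by auto
qed

lemma expand_arc_old:
  assumes "u \<in> pverts G" "w \<in> pverts G"
  shows "(u, w) \<in> parcs (expand G h T) \<longleftrightarrow> (u, w) \<in> parcs G \<and> (\<forall>t\<in>T. (u, w) \<notin> triangle_arcs t)"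
proof -
  have "(u, w) \<notin> star_arcs (h t) t" if "t \<in> T" for t
    using fresh_h[OF that] assms by (cases t) (auto simp: edges_of_def)
  then show ?thesis by (auto simp: expand_def)
qed

lemma deg_expand_fresh: "t \<in> T \<Longrightarrow> deg (expand G h T) (h t) = 3"
  using expand_nbrs_fresh[of t] triangle_distinct by (cases t) (auto simp: deg_def)

end

text \<open>A corner loses the two other corners as neighbours and gains \<open>v\<close>. The
  additive form avoids truncated subtraction.\<close>

lemma triangle_Y_deg:
  assumes G: "pair_graph G" and d: "distinct [x, y, z]" and tri: "triangle_arcs (x, y, z) \<subseteq> parcs G"
    and v: "v \<notin> pverts G" and w: "w \<in> pverts G"
    and H: "parcs H = (parcs G - triangle_arcs (x, y, z)) \<union> star_arcs v (x, y, z)"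
  shows "deg H w + (if w \<in> {x, y, z} then 1 else 0) = deg G w"
proof -
  have sub: "parcs G \<subseteq> pverts G \<times> pverts G" "finite (pverts G)"
    using G by (simp_all add: pair_graph_iff)
  have fin: "finite (parcs G `` {w})"
    by (rule finite_subset[OF _ sub(2)]) (use sub(1) in auto)
  show ?thesis
  proof (cases "w \<in> {x, y, z}")
    case True
    let ?N = "parcs G `` {w}" and ?S = "{x, y, z} - {w}"
    have v': "v \<notin> ?N" "v \<noteq> w" using v w sub by auto
    have S: "?S \<subseteq> ?N" using True d tri by (auto simp: edges_of_def)
    have "parcs H `` {w} = insert v (?N - ?S)"
      using True d v' by (auto simp: H edges_of_def)
    then have "deg H w = Suc (card (?N - ?S))"
      using fin v' by (simp add: deg_def)
    also have "card (?N - ?S) = card ?N - card ?S"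
      using S by (intro card_Diff_subset) auto
    also have "card ?S = 2" using True d by (auto simp: card_insert_if)
    finally have "deg H w = Suc (deg G w - 2)" by (simp add: deg_def)
    moreover have "card ?S \<le> deg G w" unfolding deg_def using S fin by (rule card_mono[rotated])
    ultimately show ?thesis using True \<open>card ?S = 2\<close> by simp
  next
    case False
    then have "parcs H `` {w} = parcs G `` {w}"
      using v w by (auto simp: H edges_of_def)
    then show ?thesis using False by (simp add: deg_def)
  qed
qed

text \<open>Induction on \<open>T\<close>: inserting \<open>t\<close> is a single move on the graph
  expanded so far, where \<open>t\<close> is still a triangle because earlier moves deleted none of
  its arcs. Each move costs its corners one degree.\<close>

lemma expand_cousin:
  assumes "disjoint_triangles G h T"
  shows "pair_graph (expand G h T) \<and> cousins G (expand G h T) \<and>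
    (\<forall>w\<in>pverts G. deg (expand G h T) w + card {t \<in> T. w \<in> corners t} = deg G w)"
proof -
  have "finite T" using assms by (rule disjoint_triangles.finite_T)
  then show ?thesis using assms
  proof (induction T rule: finite_induct)
    case empty
    have "expand G h {} = G" by (simp add: expand_def)
    then show ?case using empty by (simp add: cousins_def disjoint_triangles.graph)
  next
    case (insert t T)
    interpret I: disjoint_triangles G h "insert t T" by fact
    have T: "disjoint_triangles G h T"
      using disjoint_triangles_subset[OF insert.prems] by blast
    interpret J: disjoint_triangles G h T by fact
    let ?E = "expand G h T" and ?E' = "expand G h (insert t T)"
    obtain x y z where t: "t = (x, y, z)" by (cases t) auto
    have IH: "pair_graph ?E" "cousins G ?E"
      "\<And>w. w \<in> pverts G \<Longrightarrow> deg ?E w + card {t \<in> T. w \<in> corners t} = deg G w"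
      using insert.IH[OF T] by auto
    have d: "distinct [x, y, z]" using I.triangle_distinct t by blast
    have old: "triangle_arcs t \<inter> triangle_arcs s = {}" if "s \<in> T" for s
      using I.arcs_disjoint[of t s] that insert.hyps by auto
    have new: "triangle_arcs t \<inter> star_arcs (h s) s = {}" if "s \<in> insert t T" for s
      using I.corners_in[of t] I.fresh_h[OF that] by (cases s) (auto simp: edges_of_def t)
    have tri: "triangle_arcs t \<subseteq> parcs ?E"
      using I.triangle_in[of t] old by (simp add: expand_def) blast
    have v: "h t \<notin> pverts ?E"
      using I.fresh_h[of t] I.inj_h insert.hyps by (auto simp: expand_def)
    have arcs: "parcs ?E' = (parcs ?E - triangle_arcs t) \<union> star_arcs (h t) t"
      using new by (simp add: expand_def) blast
    have step: "triangle_Y ?E ?E'"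
      unfolding triangle_Y_def
    proof (intro conjI exI)
      show "{(x, y), (y, z), (z, x)} \<subseteq> parcs ?E" using tri by (auto simp: t edges_of_def)
      show "?E' = \<lparr> pverts = insert (h t) (pverts ?E),
            parcs = (parcs ?E - edges_of {(x, y), (y, z), (z, x)})
                      \<union> edges_of {(x, h t), (y, h t), (z, h t)} \<rparr>"
        using arcs by (simp add: t) (simp add: expand_def)
    qed (use IH d v in auto)
    have "deg ?E' w + card {s \<in> insert t T. w \<in> corners s} = deg G w" if w: "w \<in> pverts G" for w
    proof -
      have "w \<in> pverts ?E" using w by (simp add: expand_def)
      then have "deg ?E' w + (if w \<in> corners t then 1 else 0) = deg ?E w"
        using triangle_Y_deg[OF IH(1) d _ v, of w ?E'] tri arcs by (simp add: t)
      moreover have "card {s \<in> insert t T. w \<in> corners s} =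
          (if w \<in> corners t then 1 else 0) + card {s \<in> T. w \<in> corners s}"
      proof (cases "w \<in> corners t")
        case True
        then have "{s \<in> insert t T. w \<in> corners s} = insert t {s \<in> T. w \<in> corners s}" by auto
        then show ?thesis using True insert.hyps by simp
      next
        case False
        then have "{s \<in> insert t T. w \<in> corners s} = {s \<in> T. w \<in> corners s}" by auto
        then show ?thesis using False by simp
      qed
      ultimately show ?thesis using IH(3)[OF w] by simp
    qed
    moreover have "cousins G ?E'"
      using IH(2) step unfolding cousins_def by (auto intro: rtranclp.rtrancl_into_rtrancl)
    ultimately show ?case using triangle_Y_invariants(1)[OF step] by blast
  qed
qed

section \<open>The complete tripartite graph with parts of sizes 2, b, c, and its degrees\<close>

definition part_B :: "nat \<Rightarrow> nat set" where "part_B b = {2..<2 + b}"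
definition part_C :: "nat \<Rightarrow> nat \<Rightarrow> nat set" where "part_C b c = {2 + b..<2 + b + c}"

lemmas part_defs = part_B_def part_C_def

lemma tripartite_verts:
  "pverts (complete_tripartite 2 b c) = {0, 1} \<union> part_B b \<union> part_C b c"
  by (auto simp: complete_tripartite_def part_defs Let_def)

lemma tripartite_arcs:
  "parcs (complete_tripartite 2 b c) =
     edges_of ({0, 1} \<times> part_B b \<union> {0, 1} \<times> part_C b c \<union> part_B b \<times> part_C b c)"
proof -
  have "{0..<2::nat} = {0, 1}" by auto
  then show ?thesis by (simp add: complete_tripartite_def part_defs Let_def)
qed

lemma parts_disjoint:
  "0 \<notin> part_B b" "Suc 0 \<notin> part_B b" "0 \<notin> part_C b c" "Suc 0 \<notin> part_C b c"
  "x \<in> part_B b \<Longrightarrow> x \<notin> part_C b c"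
  by (auto simp: part_defs)

lemma finite_parts: "finite (part_B b)" "finite (part_C b c)"
  by (auto simp: part_defs)

lemma card_parts: "card (part_B b) = b" "card (part_C b c) = c"
  by (auto simp: part_defs)

lemma pair_graph_tripartite: "pair_graph (complete_tripartite 2 b c)"
  unfolding pair_graph_iff tripartite_verts tripartite_arcs
  by (auto simp: part_defs edges_of_def sym_def irrefl_def)

lemma no_isolated_tripartite:
  assumes "0 < b"
  shows "no_isolated (complete_tripartite 2 b c)"
proof -
  \<comment> \<open>The vertex 2 is a neighbour of 0 and 1, and 0 is a neighbour of every vertex in
    the two large parts.\<close>
  have "2 \<in> part_B b" using assms by (simp add: part_defs)
  then show ?thesis
    unfolding no_isolated_def tripartite_verts tripartite_arcs by (auto simp: edges_of_def)
qed

lemma deg_tripartite: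
  "deg (complete_tripartite 2 b c) 0 = b + c"
  "deg (complete_tripartite 2 b c) (Suc 0) = b + c"
  "x \<in> part_B b \<Longrightarrow> deg (complete_tripartite 2 b c) x = c + 2"
  "x \<in> part_C b c \<Longrightarrow> deg (complete_tripartite 2 b c) x = b + 2"
proof -
  let ?A = "parcs (complete_tripartite 2 b c)"
  have disj: "part_B b \<inter> part_C b c = {}" using parts_disjoint(5) by blast
  have "?A `` {0} = part_B b \<union> part_C b c" "?A `` {Suc 0} = part_B b \<union> part_C b c"
    unfolding tripartite_arcs by (auto simp: edges_of_def part_defs)
  then show "deg (complete_tripartite 2 b c) 0 = b + c"
      "deg (complete_tripartite 2 b c) (Suc 0) = b + c"
    using disj by (simp_all add: deg_def card_Un_disjoint finite_parts card_parts)
  show "deg (complete_tripartite 2 b c) x = c + 2" if "x \<in> part_B b"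
  proof -
    have "?A `` {x} = {0, 1} \<union> part_C b c"
      unfolding tripartite_arcs using that by (auto simp: edges_of_def part_defs)
    then show ?thesis using parts_disjoint
      by (simp add: deg_def finite_parts card_parts)
  qed
  show "deg (complete_tripartite 2 b c) x = b + 2" if "x \<in> part_C b c"
  proof -
    have "?A `` {x} = {0, 1} \<union> part_B b"
      unfolding tripartite_arcs using that by (auto simp: edges_of_def part_defs)
    then show ?thesis using parts_disjoint
      by (simp add: deg_def finite_parts card_parts)
  qed
qed

subsection \<open>Pairs of disjoint matchings\<close>

text \<open>A matching has at most one edge at a given vertex; \<open>f\<close> will be
  \<open>fst\<close> or \<open>snd\<close>.\<close>

lemma card_fibre:
  assumes "inj_on f M"
  shows "card {e \<in> M. f e = x} = of_bool (x \<in> f ` M)"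
proof (cases "x \<in> f ` M")
  case True
  then obtain e where "e \<in> M" "x = f e" by blast
  then have "{e \<in> M. f e = x} = {e}" using assms by (auto dest: inj_onD)
  then show ?thesis using True by simp
next
  case False
  then have "{e \<in> M. f e = x} = {}" by auto
  then show ?thesis using False by (simp only: card.empty of_bool_eq)
qed

lemma card_filter_eq_0:
  assumes "\<And>x. x \<in> S \<Longrightarrow> \<not> P x"
  shows "card {x \<in> S. P x} = 0"
proof -
  have "{x \<in> S. P x} = {}" using assms by blast
  then show ?thesis by (simp only: card.empty)
qed

text \<open>The vertices 0 and 1 form the part of size 2; \<open>M\<close> and \<open>N\<close> hold the triangles through them.\<close>

definition Y_vertex :: "nat \<Rightarrow> nat \<Rightarrow> nat \<times> nat \<times> nat \<Rightarrow> nat" where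
  "Y_vertex b c t = 2 + b + c + to_nat t"

definition matching_triangles :: "nat rel \<Rightarrow> nat rel \<Rightarrow> (nat \<times> nat \<times> nat) set" where
  "matching_triangles M N = Pair 0 ` M \<union> Pair 1 ` N"

definition matching_graph :: "nat \<Rightarrow> nat \<Rightarrow> nat rel \<Rightarrow> nat rel \<Rightarrow> nat pair_pre_digraph" where
  "matching_graph b c M N =
     expand (complete_tripartite 2 b c) (Y_vertex b c) (matching_triangles M N)"

lemma triangle_arcs_insert:
  "triangle_arcs (x, y, z) = {(x, y), (y, z), (z, x), (y, x), (z, y), (x, z)}"
  by (auto simp: edges_of_def)

text \<open>Injectivity of both projections makes \<open>M\<close> and \<open>N\<close> matchings.
  Disjointness prevents a triangle through 0 and one through 1 from sharing the edge opposite to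
  these vertices.\<close>

locale two_matchings =
  fixes b c :: nat and M N :: "nat rel"
  assumes M_sub: "M \<subseteq> part_B b \<times> part_C b c" and N_sub: "N \<subseteq> part_B b \<times> part_C b c"
    and disjoint: "M \<inter> N = {}"
    and inj_M: "inj_on fst M" "inj_on snd M"
    and inj_N: "inj_on fst N" "inj_on snd N"
begin

abbreviation "K \<equiv> complete_tripartite 2 b c"
abbreviation "T \<equiv> matching_triangles M N"
abbreviation "G \<equiv> matching_graph b c M N"

lemma finite_M: "finite M" and finite_N: "finite N"
  using M_sub N_sub finite_parts by (meson finite_SigmaI finite_subset)+

lemma T_cases:
  assumes "t \<in> T"
  obtains x y where "t = (0, x, y)" "(x, y) \<in> M" "x \<in> part_B b" "y \<in> part_C b c"
  | x y where "t = (1, x, y)" "(x, y) \<in> N" "x \<in> part_B b" "y \<in> part_C b c"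
proof -
  consider e where "t = (0, e)" "e \<in> M" | e where "t = (1, e)" "e \<in> N"
    using assms unfolding matching_triangles_def by blast
  then show thesis
  proof cases
    case 1
    then show thesis using that(1)[of "fst e" "snd e"] M_sub by (cases e) auto
  next
    case 2
    then show thesis using that(2)[of "fst e" "snd e"] N_sub by (cases e) auto
  qed
qed

lemma T_parts:
  assumes "(a, x, y) \<in> T"
  shows "a < 2" "2 \<le> x" "x < 2 + b" "2 + b \<le> y" "y < 2 + b + c"
  using assms by (cases rule: T_cases; simp add: part_defs)+

text \<open>The three alternatives are the three kinds of edge two triangles could share. The
  matching property settles the first two, disjointness of \<open>M\<close> and \<open>N\<close> the
  third.\<close>

lemma T_determined:
  assumes "(a, x, y) \<in> T" "(a', x', y') \<in> T"
    and "a = a' \<and> x = x' \<or> a = a' \<and> y = y' \<or> x = x' \<and> y = y'"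
  shows "(a, x, y) = (a', x', y')"
proof -
  have *: "y = y'" if "inj_on fst R" "(x, y) \<in> R" "(x, y') \<in> R" for R :: "nat rel" and x y y'
    using inj_onD[OF that(1) _ that(2,3)] by simp
  have **: "x = x'" if "inj_on snd R" "(x, y) \<in> R" "(x', y) \<in> R" for R :: "nat rel" and x x' y
    using inj_onD[OF that(1) _ that(2,3)] by simp
  have "a = 0 \<and> (x, y) \<in> M \<or> a = 1 \<and> (x, y) \<in> N" "a' = 0 \<and> (x', y') \<in> M \<or> a' = 1 \<and> (x', y') \<in> N"
    using assms(1,2) by (auto simp: matching_triangles_def)
  then show ?thesis
    using assms(3) disjoint *[OF inj_M(1)] *[OF inj_N(1)] **[OF inj_M(2)] **[OF inj_N(2)]
    by (elim disjE conjE) (simp, blast?)+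
qed

lemma triangles: "disjoint_triangles K (Y_vertex b c) T"
proof (rule disjoint_triangles.intro)
  show "pair_graph K" by (rule pair_graph_tripartite)
  show "finite T" by (simp add: matching_triangles_def finite_M finite_N)
  show "distinct [x, y, z]" if "(x, y, z) \<in> T" for x y z
    using T_parts[OF that] by simp
  show "triangle_arcs t \<subseteq> parcs K" if "t \<in> T" for t
    using that by (cases rule: T_cases) (auto simp: tripartite_arcs edges_of_def)
  show "triangle_arcs s \<inter> triangle_arcs t = {}" if st: "s \<in> T" "t \<in> T" "s \<noteq> t" for s t
  proof -
    obtain a x y a' x' y' where eq: "s = (a, x, y)" "t = (a', x', y')"
      by (metis prod_cases3)
    \<comment> \<open>Entries in different positions lie in different parts, so a shared arc would
      have to join the same two parts in both triangles.\<close>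
    have "a \<noteq> x'" "a \<noteq> y'" "x \<noteq> a'" "x \<noteq> y'" "y \<noteq> a'" "y \<noteq> x'"
      using T_parts[OF st(1)[unfolded eq]] T_parts[OF st(2)[unfolded eq]] by auto
    moreover
    have "\<not> (a = a' \<and> x = x' \<or> a = a' \<and> y = y' \<or> x = x' \<and> y = y')"
      using T_determined[of a x y a' x' y'] st eq by blast
    ultimately show ?thesis unfolding eq triangle_arcs_insert by (simp, metis)
  qed
  \<comment> \<open>\<open>to_nat\<close> encodes triples injectively, and the offset
    \<open>2 + b + c\<close> moves the codes past all original vertices.\<close>
  show "inj_on (Y_vertex b c) T" by (auto simp: inj_on_def Y_vertex_def)
  show "Y_vertex b c t \<notin> pverts K" if "t \<in> T" for t
    by (auto simp: Y_vertex_def tripartite_verts part_defs)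
qed

sublocale tri: disjoint_triangles K "Y_vertex b c" T
  by (rule triangles)

lemma pair_graph_G: "pair_graph G"
  using expand_cousin[OF triangles] by (simp add: matching_graph_def)

lemma cousins_G: "cousins K G"
  using expand_cousin[OF triangles] by (simp add: matching_graph_def)

lemma deg_G:
  "w \<in> pverts K \<Longrightarrow> deg G w + card {t \<in> T. w \<in> corners t} = deg K w"
  using expand_cousin[OF triangles] by (simp add: matching_graph_def)

lemma card_T_filter:
  "card {t \<in> T. P t} = card {e \<in> M. P (0, e)} + card {e \<in> N. P (1, e)}"
proof -
  have "{t \<in> T. P t} = Pair 0 ` {e \<in> M. P (0, e)} \<union> Pair 1 ` {e \<in> N. P (1, e)}"
    by (auto simp: matching_triangles_def)
  also have "card \<dots> = card (Pair (0::nat) ` {e \<in> M. P (0, e)}) + card (Pair (1::nat) ` {e \<in> N. P (1, e)})"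
    using finite_M finite_N by (intro card_Un_disjoint) auto
  also have "\<dots> = card {e \<in> M. P (0, e)} + card {e \<in> N. P (1, e)}"
    by (simp add: card_image inj_on_def)
  finally show ?thesis .
qed

lemma deg_0: "deg G 0 + card M = b + c"
proof -
  have "{e \<in> M. 0 \<in> corners (0, e)} = M" by auto
  moreover have "{e \<in> N. 0 \<in> corners (1, e)} = {}" using N_sub by (auto simp: part_defs)
  ultimately have "card {t \<in> T. 0 \<in> corners t} = card M"
    unfolding card_T_filter by (simp only: card.empty)
  then show ?thesis using deg_G[of 0] by (simp add: tripartite_verts deg_tripartite)
qed

lemma deg_1: "deg G (Suc 0) + card N = b + c"
proof -
  have "{e \<in> N. Suc 0 \<in> corners (1, e)} = N" by auto
  moreover have "{e \<in> M. Suc 0 \<in> corners (0, e)} = {}" using M_sub by (auto simp: part_defs)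
  ultimately have "card {t \<in> T. Suc 0 \<in> corners t} = card N"
    unfolding card_T_filter by (simp only: card.empty)
  then show ?thesis using deg_G[of "Suc 0"] by (simp add: tripartite_verts deg_tripartite)
qed

text \<open>Each matching that covers \<open>x\<close> puts it in exactly one triangle and so lowers
  its degree by one.\<close>

lemma deg_B:
  assumes "x \<in> part_B b"
  shows "deg G x + of_bool (x \<in> fst ` M) + of_bool (x \<in> fst ` N) = c + 2"
proof -
  have "{e \<in> M. x \<in> corners (0, e)} = {e \<in> M. fst e = x}"
    "{e \<in> N. x \<in> corners (1, e)} = {e \<in> N. fst e = x}"
    using assms M_sub N_sub by (auto simp: part_defs)
  then have "card {t \<in> T. x \<in> corners t} = of_bool (x \<in> fst ` M) + of_bool (x \<in> fst ` N)"
    unfolding card_T_filter by (simp only: card_fibre[OF inj_M(1)] card_fibre[OF inj_N(1)])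
  then show ?thesis using deg_G[of x] assms by (simp add: tripartite_verts deg_tripartite)
qed

lemma deg_C:
  assumes "x \<in> part_C b c"
  shows "deg G x + of_bool (x \<in> snd ` M) + of_bool (x \<in> snd ` N) = b + 2"
proof -
  have "{e \<in> M. x \<in> corners (0, e)} = {e \<in> M. snd e = x}"
    "{e \<in> N. x \<in> corners (1, e)} = {e \<in> N. snd e = x}"
    using assms M_sub N_sub by (auto simp: part_defs)
  then have "card {t \<in> T. x \<in> corners t} = of_bool (x \<in> snd ` M) + of_bool (x \<in> snd ` N)"
    unfolding card_T_filter by (simp only: card_fibre[OF inj_M(2)] card_fibre[OF inj_N(2)])
  then show ?thesis using deg_G[of x] assms by (simp add: tripartite_verts deg_tripartite)
qed

lemma deg_Y: "t \<in> T \<Longrightarrow> deg G (Y_vertex b c t) = 3"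
  using tri.deg_expand_fresh by (simp add: matching_graph_def)

lemma verts_G: "pverts G = {0, 1} \<union> part_B b \<union> part_C b c \<union> Y_vertex b c ` T"
  by (simp add: matching_graph_def expand_def tripartite_verts)

lemma verts_cases:
  assumes "v \<in> pverts G"
  obtains "v = 0" | "v = Suc 0" | "v \<in> part_B b" | "v \<in> part_C b c"
  | t where "t \<in> T" "v = Y_vertex b c t"
  using assms by (auto simp: verts_G)

lemma arc_old:
  assumes "u \<in> pverts K" "w \<in> pverts K" "(u, w) \<in> parcs G"
  shows "(u, w) \<in> parcs K" "t \<in> T \<Longrightarrow> (u, w) \<notin> triangle_arcs t"
  using assms tri.expand_arc_old by (auto simp: matching_graph_def)

lemma Y_arc_iff: "t \<in> T \<Longrightarrow> (Y_vertex b c t, w) \<in> parcs G \<longleftrightarrow> w \<in> corners t"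
  using tri.expand_nbrs_fresh[of t] by (auto simp: matching_graph_def)

lemma card_T: "card T = card M + card N"
  using card_T_filter[of "\<lambda>_. True"] by simp

lemma card_Y_image: "card (Y_vertex b c ` T) = card M + card N"
  using card_image[OF tri.inj_h] card_T by simp

lemma card_verts_G: "card (pverts G) = 2 + b + c + card M + card N"
proof -
  have "card (pverts G) = card ({0, 1} \<union> part_B b \<union> part_C b c) + card (Y_vertex b c ` T)"
    unfolding verts_G using tri.finite_T
    by (intro card_Un_disjoint) (auto simp: part_defs Y_vertex_def)
  also have "{0, 1} \<union> part_B b \<union> part_C b c = {0..<2 + b + c}"
    by (auto simp: part_defs)
  finally show ?thesis by (simp add: card_Y_image)
qed

text \<open>The term for the Y vertices cannot be dropped at \<open>d = b\<close>, since
  \<open>b = 3\<close> is possible.\<close>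

lemma deg_count_G:
  "deg_count G d = of_bool (deg G 0 = d) + of_bool (deg G (Suc 0) = d)
     + card {x \<in> part_B b. deg G x = d} + card {x \<in> part_C b c. deg G x = d}
     + (if d = 3 then card M + card N else 0)"
proof -
  have Y: "card {v \<in> Y_vertex b c ` T. deg G v = d} = (if d = 3 then card M + card N else 0)"
  proof (cases "d = 3")
    case True
    then have "{v \<in> Y_vertex b c ` T. deg G v = d} = Y_vertex b c ` T" using deg_Y by auto
    then show ?thesis using True card_Y_image by simp
  next
    case False
    then have "card {v \<in> Y_vertex b c ` T. deg G v = d} = 0"
      using deg_Y by (intro card_filter_eq_0) auto
    then show ?thesis using False by simp
  qed
  have A: "card {v \<in> {0, Suc 0}. deg G v = d} = of_bool (deg G 0 = d) + of_bool (deg G (Suc 0) = d)"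
  proof -
    have "{v \<in> {0, Suc 0}. deg G v = d} = {0, Suc 0} \<inter> {v. deg G v = d}" by blast
    then show ?thesis by (simp only:) (simp add: Int_insert_left)
  qed
  let ?A = "{v \<in> {0, Suc 0}. deg G v = d}" and ?B = "{x \<in> part_B b. deg G x = d}"
    and ?C = "{x \<in> part_C b c. deg G x = d}" and ?Y = "{v \<in> Y_vertex b c ` T. deg G v = d}"
  have "{v \<in> pverts G. deg G v = d} = ?A \<union> ?B \<union> ?C \<union> ?Y"
    unfolding verts_G One_nat_def by blast
  moreover have "card (?A \<union> ?B \<union> ?C \<union> ?Y) = card (?A \<union> ?B \<union> ?C) + card ?Y"
    using tri.finite_T by (intro card_Un_disjoint) (auto simp: part_defs Y_vertex_def)
  moreover have "card (?A \<union> ?B \<union> ?C) = card (?A \<union> ?B) + card ?C"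
    by (intro card_Un_disjoint) (auto simp: part_defs)
  moreover have "card (?A \<union> ?B) = card ?A + card ?B"
    by (intro card_Un_disjoint) (auto simp: part_defs)
  ultimately show ?thesis unfolding deg_count_def A Y by (simp only:)
qed

lemma card_M_le: "card M \<le> b" and card_N_le: "card N \<le> b"
proof -
  have "card (fst ` M) \<le> card (part_B b)" "card (fst ` N) \<le> card (part_B b)"
    using M_sub N_sub finite_parts by (auto intro!: card_mono)
  then show "card M \<le> b" "card N \<le> b"
    using card_image[OF inj_M(1)] card_image[OF inj_N(1)] by (simp_all add: card_parts)
qed

text \<open>The vertices of full degree are those that neither matching covers; inclusion-exclusion
  then brings in the doubly covered ones.\<close>

lemma card_max_deg_B:
  "card {x \<in> part_B b. deg G x = c + 2} + card M + card N = b + card (fst ` M \<inter> fst ` N)"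
proof -
  have sub: "fst ` M \<union> fst ` N \<subseteq> part_B b" using M_sub N_sub by auto
  have fin: "finite (fst ` M)" "finite (fst ` N)" using finite_M finite_N by auto
  have "{x \<in> part_B b. deg G x = c + 2} = part_B b - (fst ` M \<union> fst ` N)"
  proof -
    have "deg G x = c + 2 \<longleftrightarrow> x \<notin> fst ` M \<and> x \<notin> fst ` N" if "x \<in> part_B b" for x
      using deg_B[OF that] by (auto simp: of_bool_def split: if_splits)
    then show ?thesis by auto
  qed
  then have "card {x \<in> part_B b. deg G x = c + 2} + card (fst ` M \<union> fst ` N) = b"
    using sub fin card_mono[OF finite_parts(1) sub] by (simp add: card_Diff_subset card_parts)
  moreover have "card (fst ` M \<union> fst ` N) + card (fst ` M \<inter> fst ` N) = card M + card N"
    using card_Un_Int[OF fin] card_image[OF inj_M(1)] card_image[OF inj_N(1)] by simp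
  ultimately show ?thesis by simp
qed

lemma min_deg_C: "{x \<in> part_C b c. deg G x = b} = snd ` M \<inter> snd ` N"
proof -
  have "deg G x = b \<longleftrightarrow> x \<in> snd ` M \<and> x \<in> snd ` N" if "x \<in> part_C b c" for x
    using deg_C[OF that] by (auto simp: of_bool_def split: if_splits)
  moreover have "snd ` M \<subseteq> part_C b c" using M_sub by auto
  ultimately show ?thesis by blast
qed

lemma deg_B_bounds: "x \<in> part_B b \<Longrightarrow> c \<le> deg G x \<and> deg G x \<le> c + 2"
  using deg_B[of x] by (auto simp: of_bool_def split: if_splits)

lemma deg_C_bounds: "x \<in> part_C b c \<Longrightarrow> b \<le> deg G x \<and> deg G x \<le> b + 2"
  using deg_C[of x] by (auto simp: of_bool_def split: if_splits)

text \<open>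
  The parameters \<open>(card M, card N) = (b, b - 2)\<close> and \<open>(b - 1, b - 1)\<close> admit the same degree sequence;
  a path with degrees \<open>c + 2, 3, c\<close> exists only for the former.
\<close>

lemma has_deg_path_G:
  assumes "3 \<le> b" "card M = b" "card N + 2 = b"
  shows "has_deg_path G (c + 2) 3 c"
proof -
  \<comment> \<open>As \<open>b\<close> is at least 3, \<open>N\<close> has an edge. The Y vertex of
    its triangle is the middle of the path from 1 to the end \<open>x\<close> of that edge.\<close>
  have "N \<noteq> {}" using assms by auto
  then obtain x y where xy: "(x, y) \<in> N" by auto
  define v where "v = Y_vertex b c (1, x, y)"
  have t: "(1, x, y) \<in> T" using xy by (simp add: matching_triangles_def)
  have "(v, 1) \<in> parcs G" "(v, x) \<in> parcs G" using Y_arc_iff[OF t] by (auto simp: v_def)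
  then have "(1, v) \<in> parcs G" "(v, x) \<in> parcs G"
    using pair_graph_arcsD[OF pair_graph_G] by auto
  moreover have "deg G 1 = c + 2" using deg_1 assms by simp
  moreover have "deg G v = 3" using deg_Y[OF t] by (simp add: v_def)
  moreover have "deg G x = c"
  proof -
    \<comment> \<open>With \<open>b\<close> edges \<open>M\<close> covers the whole part, so
      \<open>x\<close> is covered twice.\<close>
    have "fst ` M = part_B b"
      using M_sub card_image[OF inj_M(1)] assms(2)
      by (intro card_subset_eq) (auto simp: finite_parts card_parts)
    moreover have "x \<in> part_B b" "x \<in> fst ` N" using xy N_sub by force+
    ultimately show ?thesis using deg_B[of x] by simp
  qed
  ultimately show ?thesis unfolding has_deg_path_def by blast
qed

text \<open>Here 0 and 1 have degree \<open>c + 1\<close>, so \<open>u\<close> is an uncovered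
  vertex of the \<open>b\<close>-part and no Y vertex is adjacent to it. Hence \<open>v\<close> lies
  in the \<open>c\<close>-part, and degree 3 forces \<open>b = 3\<close> with \<open>v\<close>
  covered twice. Its edges to two of the three vertices of the \<open>b\<close>-part are gone, which
  leaves only \<open>u\<close> for \<open>w\<close>.\<close>

lemma no_deg_path_G:
  assumes "3 \<le> b" "b < c" "card M + 1 = b" "card N + 1 = b"
  shows "\<not> has_deg_path G (c + 2) 3 c"
proof
  assume "has_deg_path G (c + 2) 3 c"
  then obtain u v w where uv: "(u, v) \<in> parcs G" and vw: "(v, w) \<in> parcs G"
    and du: "deg G u = c + 2" and dv: "deg G v = 3" and dw: "deg G w = c"
    unfolding has_deg_path_def by blast
  note verts = pair_graph_arcsD[OF pair_graph_G uv] pair_graph_arcsD[OF pair_graph_G vw]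
  have u: "u \<in> part_B b"
    using verts(1) by (cases rule: verts_cases)
      (use du deg_0 deg_1 deg_C_bounds[of u] deg_Y assms in auto)
  then have unc: "u \<notin> fst ` M" "u \<notin> fst ` N"
    using deg_B[OF u] du by (auto simp: of_bool_def split: if_splits)
  have w: "w \<in> part_B b \<or> w \<in> part_C b c"
    using verts(5) by (cases rule: verts_cases) (use dw deg_0 deg_1 deg_Y assms in auto)
  have v: "v \<in> part_C b c"
    using verts(2)
  proof (cases rule: verts_cases)
    case 3
    then have "(u, v) \<in> parcs K" using arc_old(1)[OF _ _ uv] u by (simp add: tripartite_verts)
    then show ?thesis using u 3 by (auto simp: tripartite_arcs edges_of_def part_defs)
  next
    case (5 t)
    then have "u \<in> corners t" using Y_arc_iff verts(3) by auto
    have "u \<in> fst ` M \<or> u \<in> fst ` N"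
      using 5(1)
    proof (cases rule: T_cases)
      case (1 x y)
      then have "u = x" using u \<open>u \<in> corners t\<close> by (auto simp: part_defs)
      then show ?thesis using 1(2) by force
    next
      case (2 x y)
      then have "u = x" using u \<open>u \<in> corners t\<close> by (auto simp: part_defs)
      then show ?thesis using 2(2) by force
    qed
    then show ?thesis using unc by blast
  qed (use dv deg_0 deg_1 assms in auto)
  have b3: "b = 3" and cov: "v \<in> snd ` M" "v \<in> snd ` N"
    using deg_C[OF v] dv assms(1) by (auto simp: of_bool_def split: if_splits)
  obtain x where x: "(x, v) \<in> M" using cov by auto
  obtain y where y: "(y, v) \<in> N" using cov by auto
  have "x \<noteq> y" using x y disjoint by auto
  have old: "v \<in> pverts K" "w \<in> pverts K"
    using v w by (auto simp: tripartite_verts)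
  have "(v, w) \<in> parcs K" using arc_old(1)[OF old vw] .
  then have wB: "w \<in> part_B b" using w v by (auto simp: tripartite_arcs edges_of_def part_defs)
  \<comment> \<open>The moves on these two triangles deleted the edges from \<open>v\<close> to
    \<open>x\<close> and to \<open>y\<close>.\<close>
  have "(0, x, v) \<in> T" "(1, y, v) \<in> T" using x y by (auto simp: matching_triangles_def)
  then have "w \<noteq> x" "w \<noteq> y"
    using arc_old(2)[OF old vw] by (force simp: edges_of_def)+
  moreover have "u \<noteq> x" "u \<noteq> y" using unc x y by force+
  moreover have "x \<in> part_B b" "y \<in> part_B b" using x y M_sub N_sub by auto
  ultimately have "w = u"
    using \<open>x \<noteq> y\<close> u wB b3 by (auto simp: part_defs)
  then show False using du dw by simp
qed

end

section \<open>Recovering the four parameters from the isomorphism class\<close>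

lemma matching_graph_iso_params_aux:
  assumes "two_matchings b c M N" "two_matchings b c M' N'" "3 \<le> b" "b < c"
    and "card N \<le> card M" "card N' \<le> card M'" "card M' \<le> card M"
    and iso: "digraph_iso (with_proj (matching_graph b c M N)) (with_proj (matching_graph b c M' N'))"
  shows "card M = card M' \<and> card N = card N' \<and>
    card (fst ` M \<inter> fst ` N) = card (fst ` M' \<inter> fst ` N') \<and>
    card (snd ` M \<inter> snd ` N) = card (snd ` M' \<inter> snd ` N')"
proof -
  interpret P: two_matchings b c M N by fact
  interpret Q: two_matchings b c M' N' by fact
  have sum: "card M + card N = card M' + card N'"
    using card_pverts_iso[OF P.pair_graph_G iso] P.card_verts_G Q.card_verts_G by simp
  have count: "deg_count Q.G d = deg_count P.G d" for d
    using deg_count_iso[OF P.pair_graph_G iso] .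
  have "\<not> card M' < card M"
  proof
    assume less: "card M' < card M"
    \<comment> \<open>The degree of vertex 1 in the first graph, which some vertex of the second
      graph must share.\<close>
    define d where "d = b + c - card N"
    have d: "deg P.G (Suc 0) = d" using P.deg_1 by (simp add: d_def)
    have "deg_count P.G d > 0" using P.deg_count_G[of d] d by simp
    then have "deg_count Q.G d > 0" using count by simp
    have "d \<le> c + 2"
    proof (rule ccontr)
      assume "\<not> d \<le> c + 2"
      moreover from this
      have "card {x \<in> part_B b. deg Q.G x = d} = 0" "card {x \<in> part_C b c. deg Q.G x = d} = 0"
        using Q.deg_B_bounds Q.deg_C_bounds \<open>b < c\<close> by (fastforce intro!: card_filter_eq_0)+
      \<comment> \<open>Equal sums give \<open>card N < card N'\<close>, and
        \<open>card N' \<le> card M'\<close>, so both small vertices of the second graph have degree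
        below \<open>d\<close>.\<close>
      moreover have "deg Q.G 0 \<noteq> d" "deg Q.G (Suc 0) \<noteq> d"
        using Q.deg_0 Q.deg_1 sum less P.card_N_le assms by (auto simp: d_def)
      ultimately have "deg_count Q.G d = 0"
        using Q.deg_count_G[of d] \<open>3 \<le> b\<close> \<open>b < c\<close> by simp
      with \<open>deg_count Q.G d > 0\<close> show False by simp
    qed
    then have "b \<le> card N + 2" by (simp add: d_def)
    \<comment> \<open>The chain
      \<open>b - 2 \<le> card N < card N' \<le> card M' < card M \<le> b\<close> leaves no other
      choice.\<close>
    then have "card M = b" "card N + 2 = b" "card M' + 1 = b" "card N' + 1 = b"
      using less sum P.card_M_le assms(5,6) by linarith+
    then show False
      using has_deg_path_iso[OF P.pair_graph_G iso] P.has_deg_path_G Q.no_deg_path_G assms by blast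
  qed
  then have M: "card M = card M'" "card N = card N'" using sum assms(7) by auto
  have a: "deg P.G 0 = deg Q.G 0" "deg P.G (Suc 0) = deg Q.G (Suc 0)"
    using P.deg_0 Q.deg_0 P.deg_1 Q.deg_1 M by auto
  \<comment> \<open>Degrees range from \<open>c\<close> to \<open>c + 2\<close> in one large part
    and from \<open>b\<close> to \<open>b + 2\<close> in the other, and these ranges can overlap.
    Since \<open>b < c\<close>, the extremes \<open>c + 2\<close> and \<open>b\<close> each occur in
    one large part only. The contributions of the small vertices and of the Y vertices agree by
    \<open>a\<close> and \<open>M\<close>.\<close>
  have "card {x \<in> part_C b c. deg P.G x = c + 2} = 0" "card {x \<in> part_C b c. deg Q.G x = c + 2} = 0"
    using P.deg_C_bounds Q.deg_C_bounds \<open>b < c\<close> by (fastforce intro!: card_filter_eq_0)+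
  then have "card {x \<in> part_B b. deg P.G x = c + 2} = card {x \<in> part_B b. deg Q.G x = c + 2}"
    using P.deg_count_G[of "c + 2"] Q.deg_count_G[of "c + 2"] count[of "c + 2"] a M
    by (simp split: if_splits)
  then have B: "card (fst ` M \<inter> fst ` N) = card (fst ` M' \<inter> fst ` N')"
    using P.card_max_deg_B Q.card_max_deg_B sum by simp
  have "card {x \<in> part_B b. deg P.G x = b} = 0" "card {x \<in> part_B b. deg Q.G x = b} = 0"
    using P.deg_B_bounds Q.deg_B_bounds \<open>b < c\<close> by (fastforce intro!: card_filter_eq_0)+
  then have "card {x \<in> part_C b c. deg P.G x = b} = card {x \<in> part_C b c. deg Q.G x = b}"
    using P.deg_count_G[of b] Q.deg_count_G[of b] count[of b] a M
    by (simp split: if_splits)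
  then show ?thesis using M B P.min_deg_C Q.min_deg_C by simp
qed

text \<open>Symmetry of isomorphism removes the assumption on which graph has the larger first
  matching.\<close>

lemma matching_graph_iso_params:
  assumes "two_matchings b c M N" "two_matchings b c M' N'" "3 \<le> b" "b < c"
    and "card N \<le> card M" "card N' \<le> card M'"
    and iso: "digraph_iso (with_proj (matching_graph b c M N)) (with_proj (matching_graph b c M' N'))"
  shows "card M = card M' \<and> card N = card N' \<and>
    card (fst ` M \<inter> fst ` N) = card (fst ` M' \<inter> fst ` N') \<and>
    card (snd ` M \<inter> snd ` N) = card (snd ` M' \<inter> snd ` N')"
proof (cases "card M' \<le> card M")
  case True
  then show ?thesis using matching_graph_iso_params_aux assms by blast
next
  case False
  have "digraph_iso (with_proj (matching_graph b c M' N')) (with_proj (matching_graph b c M N))"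
    using digraph_iso_with_proj_sym[OF pair_graph_imp_wf iso]
      two_matchings.pair_graph_G[OF assms(1)] by blast
  then show ?thesis
    using matching_graph_iso_params_aux[OF assms(2,1,3,4,6,5)] False by simp
qed

subsection \<open>Counting the parameters\<close>

lemma card_lessThan_Int_image:
  fixes s :: "nat \<Rightarrow> nat"
  assumes "inj_on s {..<j}" "m \<le> j" "\<And>k. k < j \<Longrightarrow> s k < i \<longleftrightarrow> k < m"
  shows "card ({..<i} \<inter> s ` {..<j}) = m"
proof -
  have "{..<i} \<inter> s ` {..<j} = s ` {..<m}" using assms(2,3) by fastforce
  moreover have "inj_on s {..<m}" using assms(1,2) by (auto intro: inj_on_subset)
  ultimately show ?thesis by (simp add: card_image)
qed

text \<open>Vertices are addressed by positions from 0; the shifts 2 and \<open>2 + b\<close> are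
  the first vertices of the two large parts.\<close>

definition diagonal_matching :: "nat \<Rightarrow> nat \<Rightarrow> nat rel" where
  "diagonal_matching b i = (\<lambda>k. (2 + k, 2 + b + k)) ` {..<i}"

definition indexed_matching :: "nat \<Rightarrow> (nat \<Rightarrow> nat) \<Rightarrow> (nat \<Rightarrow> nat) \<Rightarrow> nat \<Rightarrow> nat rel" where
  "indexed_matching b s r j = (\<lambda>k. (2 + s k, 2 + b + r k)) ` {..<j}"

text \<open>The diagonal matching uses only positions below \<open>i\<close>, so a coincidence of
  \<open>s k\<close> and \<open>r k\<close> is harmless from \<open>i\<close> on.\<close>

lemma indexed_matching_params:
  assumes "i \<le> b" "i \<le> c" "m \<le> j" "n \<le> j"
    and s: "inj_on s {..<j}" "\<And>k. k < j \<Longrightarrow> s k < b" "\<And>k. k < j \<Longrightarrow> s k < i \<longleftrightarrow> k < m"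
    and r: "inj_on r {..<j}" "\<And>k. k < j \<Longrightarrow> r k < c" "\<And>k. k < j \<Longrightarrow> r k < i \<longleftrightarrow> k < n"
    and sr: "\<And>k. k < j \<Longrightarrow> s k = r k \<Longrightarrow> i \<le> s k"
  defines "M \<equiv> diagonal_matching b i" and "N \<equiv> indexed_matching b s r j"
  shows "two_matchings b c M N" "card M = i" "card N = j"
    "card (fst ` M \<inter> fst ` N) = m" "card (snd ` M \<inter> snd ` N) = n"
proof -
  show "two_matchings b c M N"
  proof
    show "M \<subseteq> part_B b \<times> part_C b c" "N \<subseteq> part_B b \<times> part_C b c"
      using assms(1,2) s(2) r(2)
      by (auto simp: M_def N_def diagonal_matching_def indexed_matching_def part_defs)
    show "M \<inter> N = {}"
      using sr by (fastforce simp: M_def N_def diagonal_matching_def indexed_matching_def)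
    show "inj_on fst M" "inj_on snd M" "inj_on fst N" "inj_on snd N"
      using s(1) r(1)
      by (auto simp: M_def N_def diagonal_matching_def indexed_matching_def inj_on_def)
  qed
  show "card M = i" by (simp add: M_def diagonal_matching_def card_image inj_on_def)
  show "card N = j"
    using s(1) by (simp add: N_def indexed_matching_def card_image inj_on_def)
  have "fst ` M \<inter> fst ` N = (+) 2 ` ({..<i} \<inter> s ` {..<j})"
    by (force simp: M_def N_def diagonal_matching_def indexed_matching_def)
  then show "card (fst ` M \<inter> fst ` N) = m"
    using card_lessThan_Int_image[OF s(1) assms(3) s(3)] by (simp add: card_image inj_on_def)
  have "snd ` M \<inter> snd ` N = (+) (2 + b) ` ({..<i} \<inter> r ` {..<j})"
    by (force simp: M_def N_def diagonal_matching_def indexed_matching_def)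
  then show "card (snd ` M \<inter> snd ` N) = n"
    using card_lessThan_Int_image[OF r(1) assms(4) r(3)] by (simp add: card_image inj_on_def)
qed

text \<open>
  The second matching pairs \<open>overlap_B i m k\<close> with \<open>overlap_C i n k\<close> for \<open>k < j\<close>. The cyclic shift in
  \<open>overlap_C\<close> keeps it off the diagonal, except when \<open>i = m = n = 1\<close>, where no disjoint matching exists.
\<close>

definition overlap_B :: "nat \<Rightarrow> nat \<Rightarrow> nat \<Rightarrow> nat" where
  "overlap_B i m k = (if k < m then k else i + (k - m))"

definition overlap_C :: "nat \<Rightarrow> nat \<Rightarrow> nat \<Rightarrow> nat" where
  "overlap_C i n k = (if k < n then (if k + 1 = i then 0 else k + 1) else i + (k - n))"

text \<open>The matchings cover \<open>i + j - m\<close> and \<open>i + j - n\<close> vertices of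
  the large parts, which must fit into \<open>b\<close> and \<open>c\<close>. In the excluded case
  both would consist of the same single edge.\<close>

definition valid_params :: "nat \<Rightarrow> nat \<Rightarrow> nat \<times> nat \<times> nat \<times> nat \<Rightarrow> bool" where
  "valid_params b c = (\<lambda>(i, j, m, n). j \<le> i \<and> i \<le> b \<and> m \<le> j \<and> n \<le> j \<and>
     i + j \<le> b + m \<and> i + j \<le> c + n \<and> \<not> (i = 1 \<and> m = 1 \<and> n = 1))"

definition param_graph :: "nat \<Rightarrow> nat \<Rightarrow> nat \<times> nat \<times> nat \<times> nat \<Rightarrow> nat pair_pre_digraph" where
  "param_graph b c = (\<lambda>(i, j, m, n). matching_graph b c (diagonal_matching b i)
     (indexed_matching b (overlap_B i m) (overlap_C i n) j))"

lemma valid_params_matchings: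
  assumes "valid_params b c (i, j, m, n)" "b < c"
  defines "M \<equiv> diagonal_matching b i"
    and "N \<equiv> indexed_matching b (overlap_B i m) (overlap_C i n) j"
  shows "two_matchings b c M N" "card M = i" "card N = j"
    "card (fst ` M \<inter> fst ` N) = m" "card (snd ` M \<inter> snd ` N) = n"
proof -
  have v: "j \<le> i" "i \<le> b" "i \<le> c" "m \<le> j" "n \<le> j" "i + j \<le> b + m" "i + j \<le> c + n"
    "\<not> (i = 1 \<and> m = 1 \<and> n = 1)"
    using assms(1,2) by (auto simp: valid_params_def)
  have B: "inj_on (overlap_B i m) {..<j}" "\<And>k. k < j \<Longrightarrow> overlap_B i m k < b"
    "\<And>k. k < j \<Longrightarrow> overlap_B i m k < i \<longleftrightarrow> k < m"
    using v by (auto simp: overlap_B_def inj_on_def split: if_splits)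
  have C: "inj_on (overlap_C i n) {..<j}" "\<And>k. k < j \<Longrightarrow> overlap_C i n k < c"
    "\<And>k. k < j \<Longrightarrow> overlap_C i n k < i \<longleftrightarrow> k < n"
    using v by (auto simp: overlap_C_def inj_on_def split: if_splits)
  \<comment> \<open>A common value below \<open>i\<close> means \<open>k < m\<close> and
    \<open>k < n\<close>; the cyclic shift fixes \<open>k\<close> only if \<open>i = 1\<close>, and
    then \<open>m = n = 1\<close>.\<close>
  have BC: "i \<le> overlap_B i m k" if "k < j" "overlap_B i m k = overlap_C i n k" for k
    using that v by (auto simp: overlap_B_def overlap_C_def split: if_splits)
  show "two_matchings b c M N" "card M = i" "card N = j"
    "card (fst ` M \<inter> fst ` N) = m" "card (snd ` M \<inter> snd ` N) = n"
    unfolding M_def N_def using indexed_matching_params[OF v(2-5) B C BC] by blast+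
qed

lemma inj_on_iso_class_param_graph:
  assumes "3 \<le> b" "b < c"
  shows "inj_on (\<lambda>p. iso_class (param_graph b c p)) {p. valid_params b c p}"
proof (rule inj_onI, unfold mem_Collect_eq)
  fix p q
  assume pq: "valid_params b c p" "valid_params b c q"
    and eq: "iso_class (param_graph b c p) = iso_class (param_graph b c q)"
  obtain i j m n where p: "p = (i, j, m, n)" by (cases p) auto
  obtain i' j' m' n' where q: "q = (i', j', m', n')" by (cases q) auto
  note P = valid_params_matchings[OF pq(1)[unfolded p] assms(2)]
  note Q = valid_params_matchings[OF pq(2)[unfolded q] assms(2)]
  have "digraph_iso (with_proj (param_graph b c p)) (with_proj (param_graph b c q))"
    using eq iso_class_eq_iff two_matchings.pair_graph_G[OF P(1)] two_matchings.pair_graph_G[OF Q(1)]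
    by (simp add: p q param_graph_def)
  moreover have "j \<le> i" "j' \<le> i'" using pq by (auto simp: p q valid_params_def)
  ultimately show "p = q"
    using matching_graph_iso_params[OF P(1) Q(1) assms] P(2-5) Q(2-5)
    by (simp add: p q param_graph_def)
qed

lemma param_graph_in_family:
  assumes "valid_params b c p" "b < c"
  shows "iso_class (param_graph b c p) \<in> family (complete_tripartite 2 b c)"
proof -
  obtain i j m n where p: "p = (i, j, m, n)" by (cases p) auto
  show ?thesis
    using two_matchings.cousins_G[OF valid_params_matchings(1)[OF assms[unfolded p]]]
    by (simp add: family_def p param_graph_def)
qed

section \<open>Identifying the admissible overlaps with the summands of the bound\<close>

definition overlaps :: "nat \<Rightarrow> nat \<Rightarrow> nat \<Rightarrow> nat set" where
  "overlaps l i j = {m. m \<le> j \<and> i + j \<le> l + m}"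

lemma finite_overlaps: "finite (overlaps l i j)"
  by (rule finite_subset[of _ "{..j}"]) (auto simp: overlaps_def)

text \<open>In a part of size \<open>l\<close>, the second matching covers \<open>m\<close> of the
  \<open>i\<close> vertices already covered and \<open>j - m\<close> of the other
  \<open>l - i\<close>. The bound \<open>m \<le> i\<close> follows from
  \<open>m \<le> j\<close>.\<close>

lemma card_pairs_P:
  assumes "j \<le> i"
  shows "card (pairs_P (int i) (int l - int i) (int j)) = card (overlaps l i j)"
proof -
  have "bij_betw (\<lambda>m. (int m, int j - int m)) (overlaps l i j) (pairs_P (int i) (int l - int i) (int j))"
    unfolding bij_betw_def
  proof
    show "(\<lambda>m. (int m, int j - int m)) ` overlaps l i j = pairs_P (int i) (int l - int i) (int j)"
    proof (intro set_eqI iffI)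
      fix p assume "p \<in> pairs_P (int i) (int l - int i) (int j)"
      then obtain m n where "p = (m, n)" "0 \<le> m" "0 \<le> n" "n \<le> int l - int i" "m + n = int j"
        by (auto simp: pairs_P_def)
      then show "p \<in> (\<lambda>m. (int m, int j - int m)) ` overlaps l i j"
        by (intro image_eqI[of _ _ "nat m"]) (auto simp: overlaps_def)
    qed (use assms in \<open>auto simp: pairs_P_def overlaps_def\<close>)
  qed (auto simp: inj_on_def)
  then show ?thesis by (simp add: bij_betw_same_card)
qed

lemma ex_valid_params_card_g_bound:
  assumes "3 \<le> b" "b < c"
  shows "\<exists>S\<subseteq>{p. valid_params b c p}. card S = g_bound b c"
proof -
  \<comment> \<open>The cases with \<open>i \<le> 1\<close>; the sixth candidate
    \<open>(1, 1, 1, 1)\<close> is not valid.\<close>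
  define S0 :: "(nat \<times> nat \<times> nat \<times> nat) set" where
    "S0 = {(0, 0, 0, 0), (1, 0, 0, 0), (1, 1, 0, 0), (1, 1, 0, 1), (1, 1, 1, 0)}"
  define S1 where "S1 = (SIGMA i:{2..b}. SIGMA j:{0..i}. overlaps b i j \<times> overlaps c i j)"
  have "card S1 = (\<Sum>i = 2..b. \<Sum>j = 0..i. card (overlaps b i j) * card (overlaps c i j))"
    unfolding S1_def by (simp add: card_SigmaI finite_overlaps card_cartesian_product)
  also have "\<dots> = (\<Sum>i = 2..b. \<Sum>j = 0..i. card (pairs_P (int i) (int b - int i) (int j)) *
      card (pairs_P (int i) (int c - int i) (int j)))"
    by (intro sum.cong refl) (simp add: card_pairs_P)
  finally have "5 + card S1 = g_bound b c" by (simp add: g_bound_def)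
  moreover have "card S0 = 5" by (simp add: S0_def)
  moreover have "finite S0" "finite S1" by (auto simp: S0_def S1_def finite_overlaps)
  moreover have "S0 \<inter> S1 = {}" by (auto simp: S0_def S1_def)
  ultimately have "card (S0 \<union> S1) = g_bound b c" by (simp add: card_Un_disjoint)
  moreover have "S0 \<union> S1 \<subseteq> {p. valid_params b c p}"
    using assms by (auto simp: S0_def S1_def valid_params_def overlaps_def)
  ultimately show ?thesis by blast
qed

theorem theorem5:
  fixes b c :: nat
  assumes "3 \<le> b" and "b < c"
  shows "g_bound b c \<le> card (family (complete_tripartite 2 b c))"
proof -
  obtain S where S: "S \<subseteq> {p. valid_params b c p}" "card S = g_bound b c"
    using ex_valid_params_card_g_bound[OF assms] by blast
  have "inj_on (\<lambda>p. iso_class (param_graph b c p)) S"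
    using inj_on_iso_class_param_graph[OF assms] S(1) by (rule inj_on_subset)
  moreover have "(\<lambda>p. iso_class (param_graph b c p)) ` S \<subseteq> family (complete_tripartite 2 b c)"
    using param_graph_in_family S(1) assms(2) by blast
  moreover have "finite (family (complete_tripartite 2 b c))"
    using finite_family[OF pair_graph_tripartite no_isolated_tripartite] assms by simp
  ultimately show ?thesis using card_inj_on_le S(2) by fastforce
qed

end
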